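(* The graph $T_8$ is a minimal non-word-representable graph: $T_8$ is not word-representable, but every graph obtained from $T_8$ by deleting one vertex is word-representable.
   Context: A graph $G=(V,E)$ is word-representable if there exists a word $w$ over the alphabet $V$ such that for all distinct $x,y\in V$, the letters $x$ and $y$ alternate in $w$ if and only if $xy\in E$ (alternation meaning that deleting all letters other than $x$ and $y$ leaves $xyxy\cdots$ or $yxyx\cdots$). The graph $T_8$ has vertex set $\{1,\dots,9\}$; the vertices $1,2,3,4,5$ form a clique, the vertices $6,7,8,9$ form an independent set, and the remaining edges are: $6$ is adjacent to $1,3$; $7$ is adjacent to $2,4$; $8$ is adjacent to $1,2,5$; $9$ is adjacent to $1,2,3,4$. *)

theory Defs
  imports Main
begin

text \<open>A graph is given by a vertex set V and an edge predicate E (only its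
  values on pairs of distinct vertices of V matter; it is assumed symmetric).\<close>

definition alternate_in :: "'a list \<Rightarrow> 'a \<Rightarrow> 'a \<Rightarrow> bool" where
  "alternate_in w x y \<longleftrightarrow>
     (let u = filter (\<lambda>z. z = x \<or> z = y) w in
        (\<forall>i<length u. u ! i = (if even i then x else y)) \<or>
        (\<forall>i<length u. u ! i = (if even i then y else x)))"

definition word_representable :: "'a set \<Rightarrow> ('a \<Rightarrow> 'a \<Rightarrow> bool) \<Rightarrow> bool" where
  "word_representable V E \<longleftrightarrow>
     (\<exists>w. set w = V \<and>
          (\<forall>x\<in>V. \<forall>y\<in>V. x \<noteq> y \<longrightarrow> (alternate_in w x y \<longleftrightarrow> E x y)))"

definition T8_V :: "nat set" where
  "T8_V = {1..9}"

definition T8_edges :: "(nat \<times> nat) set" where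
  "T8_edges = {(1,2),(1,3),(1,4),(1,5),(2,3),(2,4),(2,5),(3,4),(3,5),(4,5),
               (6,1),(6,3),(7,2),(7,4),(8,1),(8,2),(8,5),
               (9,1),(9,2),(9,3),(9,4)}"

definition T8_E :: "nat \<Rightarrow> nat \<Rightarrow> bool" where
  "T8_E x y \<longleftrightarrow> (x, y) \<in> T8_edges \<or> (y, x) \<in> T8_edges"

end

theory Submission
  imports Defs
begin

text \<open>
  Letters \<open>x\<close> and \<open>y\<close> alternate, with \<open>x\<close> first, iff in every prefix the count of \<open>x\<close> exceeds that
  of \<open>y\<close> by 0 or 1. This orients a word-represented graph so that any path closed by an edge from its
  start to its end induces a transitive tournament. For such an orientation, read the order of a
  clique cyclically. A vertex outside the clique sees an arc of this cycle, and two nonadjacent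
  outside vertices cannot see two arcs that cover the cycle and overlap at both ends.
  In the clique \<open>{1, 2, 3, 4, 5}\<close> of the graph, the neighbourhoods \<open>{1, 3}\<close>, \<open>{2, 4}\<close> and \<open>{1, 2, 5}\<close>
  force the cyclic order \<open>1 3 4 2 5\<close> up to reflection, and then the arcs \<open>{2, 5, 1}\<close> of 8 and
  \<open>{1, 3, 4, 2}\<close> of 9 overlap at both 1 and 2.
\<close>

section \<open>Alternation as a condition on prefix counts\<close>

definition leads :: "'a list \<Rightarrow> 'a \<Rightarrow> 'a \<Rightarrow> bool" where
  "leads w x y \<longleftrightarrow> (\<forall>n. count_list (take n w) y \<le> count_list (take n w) x \<and>
                      count_list (take n w) x \<le> Suc (count_list (take n w) y))"

lemma leads_Nil [simp]: "leads [] x y"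
  by (simp add: leads_def)

text \<open>Once \<open>x\<close> has been read, an excess 0 or 1 of \<open>x\<close> over
  \<open>y\<close> leaves an excess 1 or 0 of \<open>y\<close> over \<open>x\<close> for the rest,
  so the roles swap.\<close>

lemma leads_Cons:
  assumes "x \<noteq> y"
  shows "leads (a # w) x y \<longleftrightarrow> (if a = x then leads w y x else a \<noteq> y \<and> leads w x y)"
proof -
  have *: "(\<forall>n. P (take n (a # w))) \<longleftrightarrow> P [] \<and> (\<forall>n. P (a # take n w))" for P
    by (metis not0_implies_Suc take0 take_Suc_Cons)
  show ?thesis
    using assms unfolding leads_def
    by (subst *) (cases "a = y"; auto intro!: exI[of _ 0])
qed

lemma alternating_filter_iff_leads:
  assumes "x \<noteq> y"
  shows "(\<forall>i<length (filter (\<lambda>z. z = x \<or> z = y) w).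
            filter (\<lambda>z. z = x \<or> z = y) w ! i = (if even i then x else y)) \<longleftrightarrow> leads w x y"
  using assms
proof (induction w arbitrary: x y)
  case Nil
  then show ?case by simp
next
  case (Cons a w)
  have swap: "filter (\<lambda>z. z = y \<or> z = x) w = filter (\<lambda>z. z = x \<or> z = y) w"
    by (rule filter_cong) auto
  show ?case
    using Cons.IH[OF Cons.prems] Cons.IH[OF Cons.prems[symmetric]] Cons.prems
    by (auto simp: leads_Cons All_less_Suc2 swap)
qed

lemma alternate_in_iff_leads:
  assumes "x \<noteq> y"
  shows "alternate_in w x y \<longleftrightarrow> leads w x y \<or> leads w y x"
proof -
  have "filter (\<lambda>z. z = y \<or> z = x) w = filter (\<lambda>z. z = x \<or> z = y) w"
    by (rule filter_cong) auto
  then show ?thesis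
    using alternating_filter_iff_leads[OF assms, of w]
      alternating_filter_iff_leads[OF assms[symmetric], of w]
    by (simp add: alternate_in_def Let_def)
qed

lemma leads_antisym:
  assumes "x \<in> set w" "leads w x y" "leads w y x"
  shows "x = y"
proof (rule ccontr)
  assume "x \<noteq> y"
  then show False
    using assms by (induction w) (auto simp: leads_Cons split: if_splits)
qed

text \<open>Around the cycle the counts can only decrease, so they are equal in every
  prefix.\<close>

lemma leads_no_cycle3:
  assumes "x \<in> set w" "leads w x y" "leads w y z" "leads w z x"
  shows "x = y"
proof (rule leads_antisym[OF assms(1,2)])
  show "leads w y x"
    using assms(2-4) unfolding leads_def by (meson le_SucI le_trans)
qed

text \<open>The counts of \<open>a\<close>, \<open>b\<close>, \<open>c\<close>, \<open>d\<close> decrease along the path, and the edge from \<open>a\<close> to \<open>d\<close>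
  bounds the total decrease by one.\<close>

lemma leads_shortcut:
  assumes "leads w a b" "leads w b c" "leads w c d" "leads w a d"
  shows "leads w a c \<and> leads w b d"
proof -
  have "count_list (take n w) c \<le> count_list (take n w) a \<and>
        count_list (take n w) a \<le> Suc (count_list (take n w) c) \<and>
        count_list (take n w) d \<le> count_list (take n w) b \<and>
        count_list (take n w) b \<le> Suc (count_list (take n w) d)" for n
    using assms[unfolded leads_def, THEN spec, of n] by linarith
  then show ?thesis
    by (simp add: leads_def)
qed

section \<open>Orientations without shortcuts\<close>

text \<open>This is semi-transitivity restricted to cycles of length 2 and 3 and to paths with three
  edges.\<close>

locale shortcut_free =
  fixes R :: "'a \<Rightarrow> 'a \<Rightarrow> bool"
  assumes asym: "R x y \<Longrightarrow> \<not> R y x"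
    and no_cycle3: "R x y \<Longrightarrow> R y z \<Longrightarrow> \<not> R z x"
    and shortcut: "R a b \<Longrightarrow> R b c \<Longrightarrow> R c d \<Longrightarrow> R a d \<Longrightarrow> R a c \<and> R b d"
begin

definition adj :: "'a \<Rightarrow> 'a \<Rightarrow> bool" where
  "adj x y \<longleftrightarrow> R x y \<or> R y x"

definition between :: "'a \<Rightarrow> 'a \<Rightarrow> 'a \<Rightarrow> bool" where
  "between a b c \<longleftrightarrow> R a b \<and> R b c \<or> R c b \<and> R b a"

text \<open>On a clique, \<open>R\<close> is a linear order; closing it up to a cyclic order, \<open>crosses a c b d\<close> says
  that the chords \<open>ac\<close> and \<open>bd\<close> cross.\<close>

definition crosses :: "'a \<Rightarrow> 'a \<Rightarrow> 'a \<Rightarrow> 'a \<Rightarrow> bool" where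
  "crosses a c b d \<longleftrightarrow> between a b c \<noteq> between a d c"

definition clique4 :: "'a \<Rightarrow> 'a \<Rightarrow> 'a \<Rightarrow> 'a \<Rightarrow> bool" where
  "clique4 a b c d \<longleftrightarrow> adj a b \<and> adj a c \<and> adj a d \<and> adj b c \<and> adj b d \<and> adj c d"

lemma trans_adj: "R x y \<Longrightarrow> R y z \<Longrightarrow> adj x z \<Longrightarrow> R x z"
  using no_cycle3 unfolding adj_def by blast

text \<open>If \<open>x\<close> came before \<open>a\<close> or after \<open>c\<close>, it would
  extend the path \<open>a b c\<close> to one closed by an edge, and the shortcut condition would
  join \<open>x\<close> to \<open>b\<close>.\<close>

lemma skips_between:
  assumes "R a b" "R b c" "adj a c" "adj x a" "adj x c" "\<not> adj x b"
  shows "R a x" "R x c"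
proof -
  have ac: "R a c"
    using assms trans_adj by blast
  show "R a x" "R x c"
    using assms ac shortcut[of x a b c] shortcut[of a b c x] no_cycle3[of a c x]
    unfolding adj_def by blast+
qed

text \<open>Exactly one of \<open>b\<close>, \<open>d\<close> lies between \<open>a\<close> and
  \<open>c\<close>; calling it \<open>q\<close> and the other \<open>s\<close> spares later proofs
  the symmetric cases.\<close>

lemma crossesE:
  assumes "clique4 a b c d" "crosses a c b d"
  obtains p q r s where "p = a \<and> r = c \<or> p = c \<and> r = a" "q = b \<and> s = d \<or> q = d \<and> s = b"
    "R p q" "R q r" "R p r" "R s p \<and> R s r \<or> R p s \<and> R r s"
proof -
  note thesis_rule = that
  have *: thesis if "p = a \<and> r = c \<or> p = c \<and> r = a" "q = b \<and> s = d \<or> q = d \<and> s = b"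
    "R p q" "R q r" "\<not> between p s r" for p q r s
  proof -
    have "adj p r" "adj p s" "adj r s"
      using assms(1) that(1,2) by (auto simp: clique4_def adj_def)
    moreover from this have "R p r"
      using that trans_adj by blast
    ultimately have "R s p \<and> R s r \<or> R p s \<and> R r s"
      using \<open>\<not> between p s r\<close> no_cycle3[of p r s] unfolding between_def adj_def by blast
    with \<open>R p r\<close> show thesis
      using that(1-4) by (intro thesis_rule[of p r q s])
  qed
  consider "between a b c" "\<not> between a d c" | "between a d c" "\<not> between a b c"
    using assms(2) by (auto simp: crosses_def)
  then show thesis
  proof cases
    case 1
    then show ?thesis
      using *[of a c b d] *[of c a b d] by (auto simp: between_def)
  next
    case 2
    then show ?thesis
      using *[of a c d b] *[of c a d b] by (auto simp: between_def)
  qed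
qed

lemma neighbourhood_not_crosses:
  assumes "clique4 a b c d" "adj x a" "adj x c" "\<not> adj x b" "\<not> adj x d"
  shows "\<not> crosses a c b d"
proof
  have out: False if "R p q" "R q r" "R p r" "R s p \<and> R s r \<or> R p s \<and> R r s"
    "adj x p" "adj x r" "\<not> adj x q" "\<not> adj x s" for p q r s
  proof -
    have "R p x" "R x r"
      using skips_between[of p q r x] that unfolding adj_def by blast+
    \<comment> \<open>The path \<open>s p x r\<close> or \<open>p x r s\<close> is closed by an
      edge, which makes \<open>x\<close> adjacent to \<open>s\<close>.\<close>
    then show False
      using that shortcut[of s p x r] shortcut[of p x r s] unfolding adj_def by blast
  qed
  assume "crosses a c b d"
  with assms(1) show False
    by (rule crossesE) (use out assms in blast)
qed

text \<open>Here the neighbourhoods \<open>{a, c, d}\<close> of \<open>x\<close> and \<open>{a, c, b}\<close> of \<open>y\<close> cover the cycle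
  \<open>a b c d\<close> and overlap at both ends.\<close>

lemma covering_neighbourhoods:
  assumes "clique4 a b c d" "crosses a c b d"
    and "adj x a" "adj x c" "adj x d" "\<not> adj x b"
    and "adj y a" "adj y c" "adj y b" "\<not> adj y d"
    and "\<not> adj x y"
  shows False
proof -
  \<comment> \<open>\<open>u\<close> is the one of \<open>x\<close>, \<open>y\<close> not adjacent
    to \<open>q\<close>; \<open>v\<close> is the other, not adjacent to \<open>s\<close>.\<close>
  have out: False if "R p q" "R q r" "R p r" "R s p \<and> R s r \<or> R p s \<and> R r s"
    "adj u p" "adj u r" "\<not> adj u q" "adj v p" "adj v r" "\<not> adj v s" "\<not> adj u v" for p q r s u v
  proof -
    have u: "R p u" "R u r"
      using skips_between[of p q r u] that unfolding adj_def by blast+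
    \<comment> \<open>Were \<open>v\<close> before \<open>p\<close> or after \<open>r\<close>, a
      shortcut would join it to \<open>u\<close>.\<close>
    have "R p v"
      using that u shortcut[of v p u r] no_cycle3[of v p r] unfolding adj_def by blast
    moreover have "R v r"
      using that u shortcut[of p u r v] calculation unfolding adj_def by blast
    ultimately show False
      using that shortcut[of s p v r] shortcut[of p v r s] unfolding adj_def by blast
  qed
  have sym: "\<not> adj y x"
    using assms by (simp add: adj_def)
  from assms(1,2) show False
    by (rule crossesE) (use out assms sym in blast)
qed

end

lemma word_shortcut_free:
  "shortcut_free (\<lambda>x y. x \<in> set w \<and> y \<in> set w \<and> x \<noteq> y \<and> leads w x y)"
proof (unfold_locales, goal_cases)
  case (1 x y)
  then show ?case using leads_antisym by metis
next
  case (2 x y z)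
  then show ?case using leads_no_cycle3 by metis
next
  case (3 a b c d)
  then show ?case
    using leads_shortcut[of w a b c d] leads_antisym by metis
qed

section \<open>The graph and its vertex-deleted subgraphs\<close>

lemma T8_not_word_representable: "\<not> word_representable T8_V T8_E"
proof
  assume "word_representable T8_V T8_E"
  then obtain w where w: "set w = T8_V"
    "\<And>x y. x \<in> T8_V \<Longrightarrow> y \<in> T8_V \<Longrightarrow> x \<noteq> y \<Longrightarrow> alternate_in w x y \<longleftrightarrow> T8_E x y"
    unfolding word_representable_def by blast
  define R where "R = (\<lambda>x y. x \<in> set w \<and> y \<in> set w \<and> x \<noteq> y \<and> leads w x y)"
  interpret shortcut_free R
    unfolding R_def by (rule word_shortcut_free)
  have adj: "adj x y \<longleftrightarrow> T8_E x y" if "x \<in> T8_V" "y \<in> T8_V" "x \<noteq> y" for x y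
    using that w alternate_in_iff_leads[of x y w] unfolding adj_def by (auto simp: R_def)
  have adj_simps: "adj x y \<longleftrightarrow> (x, y) \<in> T8_edges \<or> (y, x) \<in> T8_edges"
    if "1 \<le> x" "x \<le> 9" "1 \<le> y" "y \<le> 9" "x \<noteq> y" for x y
    using adj[of x y] that by (simp add: T8_V_def T8_E_def)
  note T8 = adj_simps clique4_def T8_edges_def
  have six: "\<not> crosses 1 3 2 4" "\<not> crosses 1 3 2 5" "\<not> crosses 1 3 4 5"
    by (rule neighbourhood_not_crosses[where x = 6]; simp add: T8)+
  have seven: "\<not> crosses 2 4 1 3" "\<not> crosses 2 4 1 5" "\<not> crosses 2 4 3 5"
    by (rule neighbourhood_not_crosses[where x = 7]; simp add: T8)+
  have eight: "\<not> crosses 1 2 3 4" "\<not> crosses 1 5 3 4" "\<not> crosses 2 5 3 4"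
    by (rule neighbourhood_not_crosses[where x = 8]; simp add: T8)+
  have not12: "\<not> crosses 1 2 3 5"
  proof
    assume "crosses 1 2 3 5"
    then show False
      by (rule covering_neighbourhoods[where x = 8 and y = 9, rotated]) (simp_all add: T8)
  qed
  have clique: "adj 1 2" "adj 1 3" "adj 1 4" "adj 1 5" "adj 2 3" "adj 2 4" "adj 2 5"
    "adj 3 4" "adj 3 5" "adj 4 5"
    by (simp_all add: T8)
  \<comment> \<open>By \<open>six\<close>, \<open>seven\<close> and \<open>eight\<close> the pairs
    13, 24 and 34 are consecutive in the cyclic order; this leaves 1 3 4 2 5, where the chord 12
    separates 3 from 5.\<close>
  show False
    using six seven eight not12 clique no_cycle3 asym
    unfolding crosses_def between_def adj_def by (smt (verit))
qed

lemma word_representableI: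
  assumes "set w = V" "\<forall>x\<in>set w. \<forall>y\<in>set w. x \<noteq> y \<longrightarrow> (leads w x y \<or> leads w y x \<longleftrightarrow> E x y)"
  shows "word_representable V E"
  unfolding word_representable_def
  using assms by (intro exI[of _ w]) (auto simp: alternate_in_iff_leads)

lemma T8_minus_vertex_word_representable:
  assumes "v \<in> T8_V"
  shows "word_representable (T8_V - {v}) T8_E"
proof -
  have V: "T8_V = {1, 2, 3, 4, 5, 6, 7, 8, 9}"
    by (auto simp: T8_V_def)
  \<comment> \<open>Each word below has every letter exactly twice and so encodes a chord diagram:
    letters alternate iff their chords cross. The clique letters form one order written
    twice.\<close>
  have "word_representable (T8_V - {1}) T8_E"
    by (rule word_representableI[of "[9, 7, 2, 4, 7, 6, 3, 6, 9, 8, 5, 2, 8, 4, 3, 5]"])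
      (subst V, force, simp add: leads_Cons T8_E_def T8_edges_def)
  moreover have "word_representable (T8_V - {2}) T8_E"
    by (rule word_representableI[of "[9, 6, 1, 3, 6, 7, 4, 7, 9, 8, 5, 1, 8, 3, 4, 5]"])
      (subst V, force, simp add: leads_Cons T8_E_def T8_edges_def)
  moreover have "word_representable (T8_V - {3}) T8_E"
    by (rule word_representableI[of "[9, 6, 1, 6, 7, 2, 4, 7, 9, 8, 5, 1, 2, 8, 4, 5]"])
      (subst V, force, simp add: leads_Cons T8_E_def T8_edges_def)
  moreover have "word_representable (T8_V - {4}) T8_E"
    by (rule word_representableI[of "[1, 6, 7, 2, 7, 9, 5, 3, 8, 1, 2, 5, 8, 9, 6, 3]"])
      (subst V, force, simp add: leads_Cons T8_E_def T8_edges_def)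
  moreover have "word_representable (T8_V - {5}) T8_E"
    by (rule word_representableI[of "[1, 6, 7, 2, 4, 7, 9, 3, 8, 1, 2, 8, 4, 9, 6, 3]"])
      (subst V, force, simp add: leads_Cons T8_E_def T8_edges_def)
  moreover have "word_representable (T8_V - {6}) T8_E"
    by (rule word_representableI[of "[9, 1, 7, 2, 4, 7, 3, 9, 8, 5, 1, 2, 8, 4, 3, 5]"])
      (subst V, force, simp add: leads_Cons T8_E_def T8_edges_def)
  moreover have "word_representable (T8_V - {7}) T8_E"
    by (rule word_representableI[of "[1, 6, 2, 9, 5, 4, 3, 8, 1, 2, 5, 8, 9, 4, 6, 3]"])
      (subst V, force, simp add: leads_Cons T8_E_def T8_edges_def)
  moreover have "word_representable (T8_V - {8}) T8_E"
    by (rule word_representableI[of "[1, 6, 7, 2, 4, 7, 9, 5, 3, 1, 2, 4, 5, 9, 6, 3]"])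
      (subst V, force, simp add: leads_Cons T8_E_def T8_edges_def)
  moreover have "word_representable (T8_V - {9}) T8_E"
    by (rule word_representableI[of "[6, 1, 3, 6, 4, 8, 2, 5, 1, 8, 3, 7, 4, 2, 7, 5]"])
      (subst V, force, simp add: leads_Cons T8_E_def T8_edges_def)
  ultimately have "\<forall>v\<in>{1, 2, 3, 4, 5, 6, 7, 8, 9}. word_representable (T8_V - {v}) T8_E"
    by blast
  then show ?thesis
    using assms V by blast
qed

theorem theorem16:
  shows "\<not> word_representable T8_V T8_E \<and>
         (\<forall>v\<in>T8_V. word_representable (T8_V - {v}) T8_E)"
  using T8_not_word_representable T8_minus_vertex_word_representable by blast

end
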